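(* Let $a,\tilde a,\alpha\in\mathbb{R}$ be such that $a\sim\tilde a\,;\,\mathrm{rp}(\alpha)$. Then $$\ln|a|\sim\ln|\tilde a|\,;\,\mathrm{ap}(\alpha).$$
   Context: For $a,\tilde a,\alpha\in\mathbb{R}$, the notation $a\sim\tilde a\,;\,\mathrm{rp}(\alpha)$ ("$\tilde a$ is an approximation to $a$ of relative precision $\alpha$") means: $\alpha\ge 0$, $a$ and $\tilde a$ are nonzero and have the same sign, and $|\ln(\tilde a/a)|\le\alpha$. For $x,\tilde x,\alpha\in\mathbb{R}$, the notation $x\sim\tilde x\,;\,\mathrm{ap}(\alpha)$ ("$\tilde x$ is an approximation to $x$ of absolute precision $\alpha$") means: $\alpha\ge 0$ and $|x-\tilde x|\le\alpha$. *)

theory Defs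
  imports Complex_Main
begin

text \<open>In both relations the arguments are the exact value, its approximation and the precision,
  in this order.\<close>

definition approx_rel :: "real \<Rightarrow> real \<Rightarrow> real \<Rightarrow> bool"
    ("(_ \<sim> _ ; rp'(_'))" [51, 51, 0] 50) where
  "a \<sim> a' ; rp(\<alpha>) \<longleftrightarrow>
     \<alpha> \<ge> 0 \<and> a \<noteq> 0 \<and> a' \<noteq> 0 \<and> sgn a = sgn a' \<and> \<bar>ln (a' / a)\<bar> \<le> \<alpha>"

definition approx_abs :: "real \<Rightarrow> real \<Rightarrow> real \<Rightarrow> bool"
    ("(_ \<sim> _ ; ap'(_'))" [51, 51, 0] 50) where
  "x \<sim> x' ; ap(\<alpha>) \<longleftrightarrow> \<alpha> \<ge> 0 \<and> \<bar>x - x'\<bar> \<le> \<alpha>"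

end

theory Submission
  imports Defs
begin

theorem mainTheorem5:
  fixes a a' \<alpha> :: real
  assumes "a \<sim> a' ; rp(\<alpha>)"
  shows "ln \<bar>a\<bar> \<sim> ln \<bar>a'\<bar> ; ap(\<alpha>)"
proof -
  have "\<alpha> \<ge> 0" and nz: "a \<noteq> 0" "a' \<noteq> 0" and sgn: "sgn a = sgn a'"
    and bound: "\<bar>ln (a' / a)\<bar> \<le> \<alpha>"
    using assms by (auto simp: approx_rel_def)
  \<comment> \<open>The common sign cancels in the quotient, which turns the relative error into a
    difference of logarithms of positive numbers.\<close>
  have "a' / a = \<bar>a'\<bar> / \<bar>a\<bar>"
    using nz sgn by (auto simp: sgn_if abs_if split: if_splits)
  then have "ln (a' / a) = ln \<bar>a'\<bar> - ln \<bar>a\<bar>"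
    using nz by (simp add: ln_div)
  with bound \<open>\<alpha> \<ge> 0\<close> show ?thesis
    by (simp add: approx_abs_def abs_minus_commute)
qed

end
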